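(* In the setting of the context, the procedure $\mathcal{H}_m(\mathcal{M},\forall\vec x\,\varphi)$ terminates, and the set $\Theta$ it returns is empty if and only if $\mathcal{M}\models\forall\vec x\,\varphi$.
   Context: $\mathcal{M}$ is an interpretation and $\varphi$ a quantifier-free formula with free variables among $\vec x=(x_1,\dots,x_n)$, $x_i$ of sort $S_i$, where each $S_i$ is interpreted in $\mathcal{M}$ as a finite nonempty set $\mathbf V_{S_i}$ of elements, each named by a term. Let $\mathbf V_{\vec x}=\mathbf V_{S_1}\times\dots\times\mathbf V_{S_n}$, fix a total order $<_{S}$ on each $\mathbf V_S$, and let $<$ be the lexicographic order on $\mathbf V_{\vec x}$ (position 1 most significant); $\vec v_{min}$ is its minimum. For $\vec v\in\mathbf V_{\vec x}$ and integer $i\ge1$, $\mathrm{next}_i(\vec v)$ is the smallest (w.r.t. $<$) tuple $\vec u$ with $\vec v<\vec u$ and $\vec u(j)\ne\vec v(j)$ for some $1\le j\le n+1-i$, if one exists, and $\vec v_{min}$ otherwise (in particular whenever $i>n$). The procedure $\mathsf{eval}(\mathcal{M},\varphi,\sigma)$, for a substitution $\sigma$ mapping $\vec x$ to $\mathbf V_{\vec x}$, returns a pair $(v,X)$ where $v\in\{\mathsf{true},\mathsf{false}\}$ is the truth value of $\varphi\sigma$ in $\mathcal{M}$ and $X\subseteq\{x_1,\dots,x_n\}$ (the critical variables) is such that $\varphi\sigma'$ has the same truth value $v$ in $\mathcal M$ for every substitution $\sigma'$ into $\mathbf V_{\vec x}$ agreeing with $\sigma$ on $X$. Procedure $\mathcal{H}_m(\mathcal{M},\forall\vec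 x\,\varphi)$: set $\Theta:=\emptyset$, $t:=\vec v_{min}$; repeat: let $(v,\{x_{i_1},\dots,x_{i_p}\}):=\mathsf{eval}(\mathcal M,\varphi,\{\vec x\mapsto t\})$; if $v=\mathsf{false}$ add $\{\vec x\mapsto t\}$ to $\Theta$; set $t:=\mathrm{next}_i(t)$ with $i=n+1-\max\{0,i_1,\dots,i_p\}$; until $t=\vec v_{min}$; return $\Theta$. Here $\mathcal{M}\models\forall\vec x\,\varphi$ means $\varphi$ holds for all assignments of $\vec x$ to $\mathbf V_{\vec x}$. *)

theory Defs
  imports Main "HOL-Library.While_Combinator"
begin

section \<open>Many-sorted quantifier-free logic\<close>

record ('f, 'p, 'v, 's) signature =
  fun_sig :: "'f \<Rightarrow> 's list \<times> 's"
  pred_sig :: "'p \<Rightarrow> 's list"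
  var_sort :: "'v \<Rightarrow> 's"

datatype (syms_tm: 'f, vars_tm: 'v) tm = Var 'v | App 'f "('f, 'v) tm list"

datatype (fsyms_qf: 'f, psyms_qf: 'p, vars_qf: 'v) qf =
    Top
  | Bot
  | Eq "('f, 'v) tm" "('f, 'v) tm"
  | Pred 'p "('f, 'v) tm list"
  | Neg "('f, 'p, 'v) qf"
  | And "('f, 'p, 'v) qf" "('f, 'p, 'v) qf"
  | Or "('f, 'p, 'v) qf" "('f, 'p, 'v) qf"
  | Imp "('f, 'p, 'v) qf" "('f, 'p, 'v) qf"
  | Iff "('f, 'p, 'v) qf" "('f, 'p, 'v) qf"

inductive has_sort :: "('f, 'p, 'v, 's) signature \<Rightarrow> ('f, 'v) tm \<Rightarrow> 's \<Rightarrow> bool"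
  for \<Sigma> where
  "has_sort \<Sigma> (Var x) (var_sort \<Sigma> x)"
| "list_all2 (has_sort \<Sigma>) ts (fst (fun_sig \<Sigma> f)) \<Longrightarrow> has_sort \<Sigma> (App f ts) (snd (fun_sig \<Sigma> f))"

primrec wf_qf :: "('f, 'p, 'v, 's) signature \<Rightarrow> ('f, 'p, 'v) qf \<Rightarrow> bool" where
  "wf_qf \<Sigma> Top = True"
| "wf_qf \<Sigma> Bot = True"
| "wf_qf \<Sigma> (Eq s t) = (\<exists>S. has_sort \<Sigma> s S \<and> has_sort \<Sigma> t S)"
| "wf_qf \<Sigma> (Pred p ts) = list_all2 (has_sort \<Sigma>) ts (pred_sig \<Sigma> p)"
| "wf_qf \<Sigma> (Neg \<phi>) = wf_qf \<Sigma> \<phi>"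
| "wf_qf \<Sigma> (And \<phi> \<psi>) = (wf_qf \<Sigma> \<phi> \<and> wf_qf \<Sigma> \<psi>)"
| "wf_qf \<Sigma> (Or \<phi> \<psi>) = (wf_qf \<Sigma> \<phi> \<and> wf_qf \<Sigma> \<psi>)"
| "wf_qf \<Sigma> (Imp \<phi> \<psi>) = (wf_qf \<Sigma> \<phi> \<and> wf_qf \<Sigma> \<psi>)"
| "wf_qf \<Sigma> (Iff \<phi> \<psi>) = (wf_qf \<Sigma> \<phi> \<and> wf_qf \<Sigma> \<psi>)"

record ('f, 'p, 's, 'a) interp =
  dom_of :: "'s \<Rightarrow> 'a set"
  fun_int :: "'f \<Rightarrow> 'a list \<Rightarrow> 'a"
  pred_int :: "'p \<Rightarrow> 'a list \<Rightarrow> bool"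

definition interpretation_of ::
  "('f, 'p, 'v, 's) signature \<Rightarrow> ('f, 'p, 's, 'a) interp \<Rightarrow> bool" where
  "interpretation_of \<Sigma> M \<longleftrightarrow>
     (\<forall>S. dom_of M S \<noteq> {}) \<and>
     (\<forall>f as. list_all2 (\<lambda>a S. a \<in> dom_of M S) as (fst (fun_sig \<Sigma> f))
        \<longrightarrow> fun_int M f as \<in> dom_of M (snd (fun_sig \<Sigma> f)))"

primrec tm_val :: "('f, 'p, 's, 'a) interp \<Rightarrow> ('v \<Rightarrow> 'a) \<Rightarrow> ('f, 'v) tm \<Rightarrow> 'a" where
  "tm_val M \<alpha> (Var x) = \<alpha> x"
| "tm_val M \<alpha> (App f ts) = fun_int M f (map (tm_val M \<alpha>) ts)"

primrec sat :: "('f, 'p, 's, 'a) interp \<Rightarrow> ('v \<Rightarrow> 'a) \<Rightarrow> ('f, 'p, 'v) qf \<Rightarrow> bool" where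
  "sat M \<alpha> Top = True"
| "sat M \<alpha> Bot = False"
| "sat M \<alpha> (Eq s t) = (tm_val M \<alpha> s = tm_val M \<alpha> t)"
| "sat M \<alpha> (Pred p ts) = pred_int M p (map (tm_val M \<alpha>) ts)"
| "sat M \<alpha> (Neg \<phi>) = (\<not> sat M \<alpha> \<phi>)"
| "sat M \<alpha> (And \<phi> \<psi>) = (sat M \<alpha> \<phi> \<and> sat M \<alpha> \<psi>)"
| "sat M \<alpha> (Or \<phi> \<psi>) = (sat M \<alpha> \<phi> \<or> sat M \<alpha> \<psi>)"
| "sat M \<alpha> (Imp \<phi> \<psi>) = (sat M \<alpha> \<phi> \<longrightarrow> sat M \<alpha> \<psi>)"
| "sat M \<alpha> (Iff \<phi> \<psi>) = (sat M \<alpha> \<phi> \<longleftrightarrow> sat M \<alpha> \<psi>)"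

text \<open>\<open>M \<Turnstile> \<forall>xs. \<phi>\<close>. Assignments are total functions, but when the variables of \<open>\<phi>\<close> are
  among \<open>xs\<close> only their values on \<open>xs\<close> matter.\<close>

definition models_forall ::
  "('f, 'p, 'v, 's) signature \<Rightarrow> ('f, 'p, 's, 'a) interp \<Rightarrow> 'v list \<Rightarrow> ('f, 'p, 'v) qf \<Rightarrow> bool" where
  "models_forall \<Sigma> M xs \<phi> \<longleftrightarrow>
     (\<forall>\<alpha>. (\<forall>x \<in> set xs. \<alpha> x \<in> dom_of M (var_sort \<Sigma> x)) \<longrightarrow> sat M \<alpha> \<phi>)"

text \<open>Only used for ground formulas, whose truth value does not depend on the assignment.\<close>

definition ground_true :: "('f, 'p, 's, 'a) interp \<Rightarrow> ('f, 'p, 'v) qf \<Rightarrow> bool" where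
  "ground_true M \<phi> \<longleftrightarrow> (\<forall>\<alpha>. sat M \<alpha> \<phi>)"

primrec tm_subst :: "('v \<Rightarrow> ('f, 'v) tm) \<Rightarrow> ('f, 'v) tm \<Rightarrow> ('f, 'v) tm" where
  "tm_subst \<sigma> (Var x) = \<sigma> x"
| "tm_subst \<sigma> (App f ts) = App f (map (tm_subst \<sigma>) ts)"

primrec qf_subst :: "('v \<Rightarrow> ('f, 'v) tm) \<Rightarrow> ('f, 'p, 'v) qf \<Rightarrow> ('f, 'p, 'v) qf" where
  "qf_subst \<sigma> Top = Top"
| "qf_subst \<sigma> Bot = Bot"
| "qf_subst \<sigma> (Eq s t) = Eq (tm_subst \<sigma> s) (tm_subst \<sigma> t)"
| "qf_subst \<sigma> (Pred p ts) = Pred p (map (tm_subst \<sigma>) ts)"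
| "qf_subst \<sigma> (Neg \<phi>) = Neg (qf_subst \<sigma> \<phi>)"
| "qf_subst \<sigma> (And \<phi> \<psi>) = And (qf_subst \<sigma> \<phi>) (qf_subst \<sigma> \<psi>)"
| "qf_subst \<sigma> (Or \<phi> \<psi>) = Or (qf_subst \<sigma> \<phi>) (qf_subst \<sigma> \<psi>)"
| "qf_subst \<sigma> (Imp \<phi> \<psi>) = Imp (qf_subst \<sigma> \<phi>) (qf_subst \<sigma> \<psi>)"
| "qf_subst \<sigma> (Iff \<phi> \<psi>) = Iff (qf_subst \<sigma> \<phi>) (qf_subst \<sigma> \<psi>)"


section \<open>Tuples of values\<close>

definition tuples ::
  "('f, 'p, 'v, 's) signature \<Rightarrow> ('f, 'p, 's, 'a) interp \<Rightarrow> 'v list \<Rightarrow> 'a list set" where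
  "tuples \<Sigma> M xs = {t. list_all2 (\<lambda>a x. a \<in> dom_of M (var_sort \<Sigma> x)) t xs}"

text \<open>\<open>nm S a\<close> is the term naming the element \<open>a\<close> of sort \<open>S\<close>.\<close>

definition names_elements ::
  "('f, 'p, 'v, 's) signature \<Rightarrow> ('f, 'p, 's, 'a) interp \<Rightarrow> ('s \<Rightarrow> 'a \<Rightarrow> ('f, 'v) tm) \<Rightarrow> 's \<Rightarrow> bool" where
  "names_elements \<Sigma> M nm S \<longleftrightarrow>
     (\<forall>a \<in> dom_of M S. vars_tm (nm S a) = {} \<and> has_sort \<Sigma> (nm S a) S \<and>
        (\<forall>\<alpha>. tm_val M \<alpha> (nm S a) = a))"

definition tuple_subst ::
  "('f, 'p, 'v, 's) signature \<Rightarrow> ('s \<Rightarrow> 'a \<Rightarrow> ('f, 'v) tm) \<Rightarrow> 'v list \<Rightarrow> 'a list \<Rightarrow> 'v \<Rightarrow> ('f, 'v) tm" where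
  "tuple_subst \<Sigma> nm xs t x =
     (case map_of (zip xs t) x of None \<Rightarrow> Var x | Some a \<Rightarrow> nm (var_sort \<Sigma> x) a)"

text \<open>The library's lexicographic orders use one relation for all positions; here the relation at
  a position is the one belonging to the sort of the variable at that position.\<close>

definition lex_less ::
  "('f, 'p, 'v, 's) signature \<Rightarrow> ('s \<Rightarrow> ('a \<times> 'a) set) \<Rightarrow> 'v list \<Rightarrow> 'a list \<Rightarrow> 'a list \<Rightarrow> bool" where
  "lex_less \<Sigma> lt xs u v \<longleftrightarrow>
     (\<exists>k < length xs. (\<forall>j < k. u ! j = v ! j) \<and> (u ! k, v ! k) \<in> lt (var_sort \<Sigma> (xs ! k)))"

definition lex_min ::
  "('f, 'p, 'v, 's) signature \<Rightarrow> ('s \<Rightarrow> ('a \<times> 'a) set) \<Rightarrow> 'v list \<Rightarrow> 'a list set \<Rightarrow> 'a list" where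
  "lex_min \<Sigma> lt xs A = (THE u. u \<in> A \<and> (\<forall>w \<in> A. w \<noteq> u \<longrightarrow> lex_less \<Sigma> lt xs u w))"

definition v_min ::
  "('f, 'p, 'v, 's) signature \<Rightarrow> ('f, 'p, 's, 'a) interp \<Rightarrow> ('s \<Rightarrow> ('a \<times> 'a) set) \<Rightarrow> 'v list \<Rightarrow> 'a list" where
  "v_min \<Sigma> M lt xs = lex_min \<Sigma> lt xs (tuples \<Sigma> M xs)"

text \<open>Positions are numbered from 1 and lists from 0. The bound \<open>j \<le> n + 1 - i\<close> is written as
  \<open>j + i \<le> n + 1\<close> to avoid truncated subtraction.\<close>

definition next_cands ::
  "('f, 'p, 'v, 's) signature \<Rightarrow> ('f, 'p, 's, 'a) interp \<Rightarrow> ('s \<Rightarrow> ('a \<times> 'a) set) \<Rightarrow> 'v list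
    \<Rightarrow> nat \<Rightarrow> 'a list \<Rightarrow> 'a list set" where
  "next_cands \<Sigma> M lt xs i v =
     {u \<in> tuples \<Sigma> M xs. lex_less \<Sigma> lt xs v u \<and>
        (\<exists>j. 1 \<le> j \<and> j + i \<le> length xs + 1 \<and> u ! (j - 1) \<noteq> v ! (j - 1))}"

definition next_tuple ::
  "('f, 'p, 'v, 's) signature \<Rightarrow> ('f, 'p, 's, 'a) interp \<Rightarrow> ('s \<Rightarrow> ('a \<times> 'a) set) \<Rightarrow> 'v list
    \<Rightarrow> nat \<Rightarrow> 'a list \<Rightarrow> 'a list" where
  "next_tuple \<Sigma> M lt xs i v =
     (if next_cands \<Sigma> M lt xs i v = {} then v_min \<Sigma> M lt xs
      else lex_min \<Sigma> lt xs (next_cands \<Sigma> M lt xs i v))"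


section \<open>The instantiation procedure\<close>

type_synonym ('f, 'p, 'v, 's, 'a) eval_proc =
  "('f, 'p, 's, 'a) interp \<Rightarrow> ('f, 'p, 'v) qf \<Rightarrow> ('v \<Rightarrow> ('f, 'v) tm) \<Rightarrow> bool \<times> 'v set"

definition eval_correct ::
  "('f, 'p, 'v, 's) signature \<Rightarrow> ('f, 'p, 's, 'a) interp \<Rightarrow> ('s \<Rightarrow> 'a \<Rightarrow> ('f, 'v) tm) \<Rightarrow> 'v list
    \<Rightarrow> ('f, 'p, 'v) qf \<Rightarrow> ('f, 'p, 'v, 's, 'a) eval_proc \<Rightarrow> bool" where
  "eval_correct \<Sigma> M nm xs \<phi> eval \<longleftrightarrow>
     (\<forall>\<sigma> \<in> tuple_subst \<Sigma> nm xs ` tuples \<Sigma> M xs.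
        case eval M \<phi> \<sigma> of (v, X) \<Rightarrow>
          (v \<longleftrightarrow> ground_true M (qf_subst \<sigma> \<phi>)) \<and> X \<subseteq> set xs \<and>
          (\<forall>\<sigma>' \<in> tuple_subst \<Sigma> nm xs ` tuples \<Sigma> M xs.
             (\<forall>x \<in> X. \<sigma>' x = \<sigma> x) \<longrightarrow> (ground_true M (qf_subst \<sigma>' \<phi>) \<longleftrightarrow> v)))"

definition max_pos :: "'v list \<Rightarrow> 'v set \<Rightarrow> nat" where
  "max_pos xs X = Max (insert 0 {i. 1 \<le> i \<and> i \<le> length xs \<and> xs ! (i - 1) \<in> X})"

definition Hm_body ::
  "('f, 'p, 'v, 's) signature \<Rightarrow> ('s \<Rightarrow> ('a \<times> 'a) set) \<Rightarrow> ('s \<Rightarrow> 'a \<Rightarrow> ('f, 'v) tm)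
    \<Rightarrow> ('f, 'p, 'v, 's, 'a) eval_proc \<Rightarrow> ('f, 'p, 's, 'a) interp \<Rightarrow> 'v list \<Rightarrow> ('f, 'p, 'v) qf
    \<Rightarrow> ('v \<Rightarrow> ('f, 'v) tm) set \<times> 'a list \<Rightarrow> ('v \<Rightarrow> ('f, 'v) tm) set \<times> 'a list" where
  "Hm_body \<Sigma> lt nm eval M xs \<phi> = (\<lambda>(\<Theta>, t).
     let \<sigma> = tuple_subst \<Sigma> nm xs t;
         (v, X) = eval M \<phi> \<sigma>
     in (if v then \<Theta> else insert \<sigma> \<Theta>,
         next_tuple \<Sigma> M lt xs (length xs + 1 - max_pos xs X) t))"

text \<open>A repeat-until loop: the body runs once before the first test. The result is \<open>None\<close> exactly
  when the loop does not terminate.\<close>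

definition Hm ::
  "('f, 'p, 'v, 's) signature \<Rightarrow> ('s \<Rightarrow> ('a \<times> 'a) set) \<Rightarrow> ('s \<Rightarrow> 'a \<Rightarrow> ('f, 'v) tm)
    \<Rightarrow> ('f, 'p, 'v, 's, 'a) eval_proc \<Rightarrow> ('f, 'p, 's, 'a) interp \<Rightarrow> 'v list \<Rightarrow> ('f, 'p, 'v) qf
    \<Rightarrow> ('v \<Rightarrow> ('f, 'v) tm) set option" where
  "Hm \<Sigma> lt nm eval M xs \<phi> =
     map_option fst
       (while_option (\<lambda>(\<Theta>, t). t \<noteq> v_min \<Sigma> M lt xs) (Hm_body \<Sigma> lt nm eval M xs \<phi>)
          (Hm_body \<Sigma> lt nm eval M xs \<phi> ({}, v_min \<Sigma> M lt xs)))"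

end

theory Submission imports Defs begin

text \<open>If \<open>m\<close> is the last position of a critical variable at \<open>t\<close>, every tuple skipped by
  \<open>next\<close> agrees with \<open>t\<close> on the first \<open>m\<close> positions, hence gives \<open>\<phi>\<close> the same truth value as
  \<open>t\<close>. So whenever the loop reaches \<open>t\<close>, \<open>\<Theta>\<close> is empty exactly if \<open>\<phi>\<close> holds at all tuples
  below \<open>t\<close>; and \<open>t\<close> strictly increases until it wraps around to the minimum, at which point
  all tuples have been covered.\<close>

section \<open>Substitution and coincidence lemmas\<close>

lemma tm_val_subst: "tm_val M \<alpha> (tm_subst \<sigma> t) = tm_val M (\<lambda>x. tm_val M \<alpha> (\<sigma> x)) t"
  by (induction t) (auto cong: map_cong simp: comp_def)

lemma sat_subst: "sat M \<alpha> (qf_subst \<sigma> \<phi>) \<longleftrightarrow> sat M (\<lambda>x. tm_val M \<alpha> (\<sigma> x)) \<phi>"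
  by (induction \<phi>) (auto simp: tm_val_subst comp_def)

lemma tm_val_cong: "(\<And>x. x \<in> vars_tm t \<Longrightarrow> \<alpha> x = \<beta> x) \<Longrightarrow> tm_val M \<alpha> t = tm_val M \<beta> t"
proof (induction t)
  case (App f ts)
  have "map (tm_val M \<alpha>) ts = map (tm_val M \<beta>) ts"
    using App by (intro map_cong refl) auto
  then show ?case by (simp only: tm_val.simps)
qed simp

lemma sat_cong: "(\<And>x. x \<in> vars_qf \<phi> \<Longrightarrow> \<alpha> x = \<beta> x) \<Longrightarrow> sat M \<alpha> \<phi> \<longleftrightarrow> sat M \<beta> \<phi>"
proof (induction \<phi>)
  case (Eq s t)
  then have "tm_val M \<alpha> s = tm_val M \<beta> s" "tm_val M \<alpha> t = tm_val M \<beta> t"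
    by (auto intro!: tm_val_cong)
  then show ?case by simp
next
  case (Pred p ts)
  then have "map (tm_val M \<alpha>) ts = map (tm_val M \<beta>) ts"
    by (intro map_cong refl tm_val_cong) auto
  then show ?case by (simp only: sat.simps)
qed auto

section \<open>Tuples of values and their substitutions\<close>

lemma length_tuples: "t \<in> tuples \<Sigma> M xs \<Longrightarrow> length t = length xs"
  by (auto simp: tuples_def dest: list_all2_lengthD)

lemma nth_tuples:
  "t \<in> tuples \<Sigma> M xs \<Longrightarrow> k < length xs \<Longrightarrow> t ! k \<in> dom_of M (var_sort \<Sigma> (xs ! k))"
  by (auto simp: tuples_def list_all2_conv_all_nth)

lemma finite_tuples:
  assumes "\<And>x. x \<in> set xs \<Longrightarrow> finite (dom_of M (var_sort \<Sigma> x))"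
  shows "finite (tuples \<Sigma> M xs)"
proof (rule finite_subset)
  show "tuples \<Sigma> M xs \<subseteq> {t. set t \<subseteq> (\<Union>x\<in>set xs. dom_of M (var_sort \<Sigma> x)) \<and> length t = length xs}"
    by (fastforce simp: tuples_def list_all2_conv_all_nth in_set_conv_nth)
  show "finite {t. set t \<subseteq> (\<Union>x\<in>set xs. dom_of M (var_sort \<Sigma> x)) \<and> length t = length xs}"
    using assms by (intro finite_lists_length_eq) auto
qed

lemma tuples_nonempty:
  assumes "\<And>x. x \<in> set xs \<Longrightarrow> dom_of M (var_sort \<Sigma> x) \<noteq> {}"
  shows "tuples \<Sigma> M xs \<noteq> {}"
proof -
  have "map (\<lambda>x. SOME a. a \<in> dom_of M (var_sort \<Sigma> x)) xs \<in> tuples \<Sigma> M xs"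
    using assms by (auto simp: tuples_def list_all2_conv_all_nth some_in_eq)
  then show ?thesis by blast
qed

lemma tuple_subst_nth:
  assumes "distinct xs" "t \<in> tuples \<Sigma> M xs" "k < length xs"
  shows "tuple_subst \<Sigma> nm xs t (xs ! k) = nm (var_sort \<Sigma> (xs ! k)) (t ! k)"
  using assms length_tuples[OF assms(2)] by (simp add: tuple_subst_def map_of_zip_nth)

text \<open>A name evaluates to its element under every assignment, so substituting names for
  \<open>xs\<close> amounts to evaluating \<open>\<phi>\<close> under an assignment with the values
  of the tuple. Conversely an assignment \<open>\<alpha>\<close> yields the tuple
  \<open>map \<alpha> xs\<close>; its values outside \<open>xs\<close> do not reach
  \<open>\<phi>\<close>.\<close>

lemma models_forall_iff_tuples:
  assumes "distinct xs" "vars_qf \<phi> \<subseteq> set xs"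
    and names: "\<And>x. x \<in> set xs \<Longrightarrow> names_elements \<Sigma> M nm (var_sort \<Sigma> x)"
  shows "models_forall \<Sigma> M xs \<phi> \<longleftrightarrow>
    (\<forall>t\<in>tuples \<Sigma> M xs. ground_true M (qf_subst (tuple_subst \<Sigma> nm xs t) \<phi>))"
proof -
  have val: "tm_val M \<alpha> (tuple_subst \<Sigma> nm xs t (xs ! k)) = t ! k"
    if "t \<in> tuples \<Sigma> M xs" "k < length xs" for \<alpha> t k
    using names[of "xs ! k"] that nth_tuples[OF that] tuple_subst_nth[OF assms(1) that]
    by (simp add: names_elements_def)
  show ?thesis
  proof (intro iffI ballI)
    fix t assume mf: "models_forall \<Sigma> M xs \<phi>" and t: "t \<in> tuples \<Sigma> M xs"
    \<comment> \<open>By \<open>sat_subst\<close>, the assignment to be fed into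
      \<open>models_forall\<close> is the one sending \<open>x\<close> to the value of its
      substituted term.\<close>
    have "\<forall>x\<in>set xs. tm_val M \<alpha> (tuple_subst \<Sigma> nm xs t x) \<in> dom_of M (var_sort \<Sigma> x)" for \<alpha>
      using val[OF t] nth_tuples[OF t] by (auto simp: in_set_conv_nth)
    then show "ground_true M (qf_subst (tuple_subst \<Sigma> nm xs t) \<phi>)"
      using mf by (simp add: ground_true_def sat_subst models_forall_def)
  next
    assume all: "\<forall>t\<in>tuples \<Sigma> M xs. ground_true M (qf_subst (tuple_subst \<Sigma> nm xs t) \<phi>)"
    show "models_forall \<Sigma> M xs \<phi>"
      unfolding models_forall_def
    proof (intro allI impI)
      fix \<alpha> assume "\<forall>x\<in>set xs. \<alpha> x \<in> dom_of M (var_sort \<Sigma> x)"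
      then have t: "map \<alpha> xs \<in> tuples \<Sigma> M xs"
        by (simp add: tuples_def list_all2_conv_all_nth)
      have "sat M (\<lambda>x. tm_val M \<alpha> (tuple_subst \<Sigma> nm xs (map \<alpha> xs) x)) \<phi>"
        using all t by (simp add: ground_true_def sat_subst)
      moreover have "tm_val M \<alpha> (tuple_subst \<Sigma> nm xs (map \<alpha> xs) x) = \<alpha> x" if "x \<in> vars_qf \<phi>" for x
      proof -
        have "x \<in> set xs" using that assms(2) by blast
        then obtain k where "k < length xs" "xs ! k = x" by (auto simp: in_set_conv_nth)
        then show ?thesis using val[OF t, of k \<alpha>] by simp
      qed
      ultimately show "sat M \<alpha> \<phi>" by (blast dest: sat_cong[THEN iffD1, rotated])
    qed
  qed
qed

section \<open>The lexicographic order on tuples\<close>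

lemma lex_less_trans:
  assumes "\<And>x. x \<in> set xs \<Longrightarrow> trans (lt (var_sort \<Sigma> x))"
    and "lex_less \<Sigma> lt xs u v" "lex_less \<Sigma> lt xs v w"
  shows "lex_less \<Sigma> lt xs u w"
proof -
  obtain k where k: "k < length xs" "\<forall>j<k. u ! j = v ! j"
    "(u ! k, v ! k) \<in> lt (var_sort \<Sigma> (xs ! k))"
    using assms(2) by (auto simp: lex_less_def)
  obtain l where l: "l < length xs" "\<forall>j<l. v ! j = w ! j"
    "(v ! l, w ! l) \<in> lt (var_sort \<Sigma> (xs ! l))"
    using assms(3) by (auto simp: lex_less_def)
  \<comment> \<open>If \<open>k\<close> and \<open>l\<close> differ, one of the two comparisons is
    an equality at the smaller position and the other one decides; only \<open>k = l\<close> uses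
    transitivity in the sort.\<close>
  have "(u ! min k l, w ! min k l) \<in> lt (var_sort \<Sigma> (xs ! min k l))"
  proof (cases k l rule: linorder_cases)
    case equal
    then show ?thesis using k l assms(1)[of "xs ! k"] by (auto dest: transD)
  qed (use k l in \<open>auto simp: min_def\<close>)
  then show ?thesis
    unfolding lex_less_def using k l by (intro exI[of _ "min k l"]) auto
qed

lemma lex_less_irrefl:
  assumes "\<And>x. x \<in> set xs \<Longrightarrow> irrefl (lt (var_sort \<Sigma> x))"
  shows "\<not> lex_less \<Sigma> lt xs u u"
  using assms by (auto simp: lex_less_def irrefl_def)

lemma lex_less_total:
  assumes "\<And>x. x \<in> set xs \<Longrightarrow> total_on (dom_of M (var_sort \<Sigma> x)) (lt (var_sort \<Sigma> x))"
    and "u \<in> tuples \<Sigma> M xs" "v \<in> tuples \<Sigma> M xs" "u \<noteq> v"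
  shows "lex_less \<Sigma> lt xs u v \<or> lex_less \<Sigma> lt xs v u"
proof -
  have "\<exists>k. k < length xs \<and> u ! k \<noteq> v ! k"
    using assms(2-4) by (metis length_tuples nth_equalityI)
  \<comment> \<open>The first position at which the tuples differ decides the comparison.\<close>
  then obtain k where k: "k < length xs" "u ! k \<noteq> v ! k"
    and least: "\<And>j. j < k \<Longrightarrow> \<not> (j < length xs \<and> u ! j \<noteq> v ! j)"
    unfolding exists_least_iff[of "\<lambda>k. k < length xs \<and> u ! k \<noteq> v ! k"] by blast
  have "\<forall>j<k. u ! j = v ! j" "\<forall>j<k. v ! j = u ! j"
    using least k(1) by fastforce+
  moreover have "(u ! k, v ! k) \<in> lt (var_sort \<Sigma> (xs ! k)) \<or> (v ! k, u ! k) \<in> lt (var_sort \<Sigma> (xs ! k))"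
    using assms(1)[of "xs ! k"] k nth_tuples[OF assms(2)] nth_tuples[OF assms(3)]
    by (auto simp: total_on_def)
  ultimately show ?thesis
    using k unfolding lex_less_def by blast
qed

section \<open>The last critical position\<close>

lemma max_pos_le: "max_pos xs X \<le> length xs"
  by (auto simp: max_pos_def)

lemma max_pos_ge: "k < length xs \<Longrightarrow> xs ! k \<in> X \<Longrightarrow> Suc k \<le> max_pos xs X"
  unfolding max_pos_def by (intro Max_ge) auto

section \<open>Analysis of the loop\<close>

locale instantiation_setting =
  fixes \<Sigma> :: "('f, 'p, 'v, 's) signature"
    and M :: "('f, 'p, 's, 'a) interp"
    and xs :: "'v list"
    and \<phi> :: "('f, 'p, 'v) qf"
    and lt :: "'s \<Rightarrow> ('a \<times> 'a) set"
    and nm :: "'s \<Rightarrow> 'a \<Rightarrow> ('f, 'v) tm"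
    and eval :: "('f, 'p, 'v, 's, 'a) eval_proc"
  assumes distinct_xs: "distinct xs"
    and finite_dom: "\<And>x. x \<in> set xs \<Longrightarrow> finite (dom_of M (var_sort \<Sigma> x))"
    and nonempty_dom: "\<And>x. x \<in> set xs \<Longrightarrow> dom_of M (var_sort \<Sigma> x) \<noteq> {}"
    and order_dom:
      "\<And>x. x \<in> set xs \<Longrightarrow> strict_linear_order_on (dom_of M (var_sort \<Sigma> x)) (lt (var_sort \<Sigma> x))"
    and correct: "eval_correct \<Sigma> M nm xs \<phi> eval"
begin

abbreviation T where "T \<equiv> tuples \<Sigma> M xs"
abbreviation less (infix "\<sqsubset>" 50) where "u \<sqsubset> v \<equiv> lex_less \<Sigma> lt xs u v"
abbreviation vmin where "vmin \<equiv> v_min \<Sigma> M lt xs"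
abbreviation body where "body \<equiv> Hm_body \<Sigma> lt nm eval M xs \<phi>"

definition holds_at :: "'a list \<Rightarrow> bool" where
  "holds_at t \<longleftrightarrow> ground_true M (qf_subst (tuple_subst \<Sigma> nm xs t) \<phi>)"

lemma trans_less: "u \<sqsubset> v \<Longrightarrow> v \<sqsubset> w \<Longrightarrow> u \<sqsubset> w"
  using lex_less_trans order_dom unfolding strict_linear_order_on_def by metis

lemma irrefl_less: "\<not> u \<sqsubset> u"
  using lex_less_irrefl order_dom unfolding strict_linear_order_on_def by metis

lemma total_less: "u \<in> T \<Longrightarrow> v \<in> T \<Longrightarrow> u \<noteq> v \<Longrightarrow> u \<sqsubset> v \<or> v \<sqsubset> u"
  using lex_less_total order_dom unfolding strict_linear_order_on_def by metis

lemma finite_T: "finite T"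
  using finite_tuples finite_dom by blast

text \<open>Finiteness, transitivity and totality give a least element; two of them would lie below
  each other, against irreflexivity. Hence the \<open>THE\<close> in \<open>lex_min\<close> is well
  defined.\<close>

lemma lex_min_least:
  assumes "A \<subseteq> T" "A \<noteq> {}"
  shows "lex_min \<Sigma> lt xs A \<in> A" "\<And>w. w \<in> A \<Longrightarrow> w \<noteq> lex_min \<Sigma> lt xs A \<Longrightarrow> lex_min \<Sigma> lt xs A \<sqsubset> w"
proof -
  have "\<exists>m\<in>A. \<forall>w\<in>A. w \<noteq> m \<longrightarrow> m \<sqsubset> w"
  proof (rule Finite_Set.bex_least_element)
    show "finite A" using assms finite_T finite_subset by blast
    show "A \<noteq> {}" by fact
    show "transp_on A (\<sqsubset>)"
      using trans_less by (blast intro: transp_onI)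
    show "totalp_on A (\<sqsubset>)"
      using total_less assms(1) by (blast intro: totalp_onI)
  qed
  then have "\<exists>!m. m \<in> A \<and> (\<forall>w\<in>A. w \<noteq> m \<longrightarrow> m \<sqsubset> w)"
    using trans_less irrefl_less by metis
  from theI'[OF this] show "lex_min \<Sigma> lt xs A \<in> A"
    "\<And>w. w \<in> A \<Longrightarrow> w \<noteq> lex_min \<Sigma> lt xs A \<Longrightarrow> lex_min \<Sigma> lt xs A \<sqsubset> w"
    unfolding lex_min_def by auto
qed

lemma vmin_in_T: "vmin \<in> T"
  unfolding v_min_def using lex_min_least(1)[of T] tuples_nonempty nonempty_dom by blast

lemma not_less_vmin: "u \<in> T \<Longrightarrow> \<not> u \<sqsubset> vmin"
  unfolding v_min_def
  using lex_min_least(2)[of T u] irrefl_less trans_less by blast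

text \<open>Lying above \<open>t\<close> without being a candidate forces \<open>u\<close> to agree
  with \<open>t\<close> up to position \<open>max_pos xs X\<close>. All critical variables occur
  there, so the two substitutions agree on \<open>X\<close> and \<open>eval_correct\<close> applies.
  For empty \<open>X\<close> there are no candidates, and every tuple above \<open>t\<close> counts
  as skipped.\<close>

lemma holds_at_skipped:
  assumes t: "t \<in> T" and u: "u \<in> T" and ev: "eval M \<phi> (tuple_subst \<Sigma> nm xs t) = (v, X)"
    and less: "t \<sqsubset> u"
    and skipped: "u \<notin> next_cands \<Sigma> M lt xs (length xs + 1 - max_pos xs X) t"
  shows "holds_at u \<longleftrightarrow> holds_at t"
proof -
  have eq: "u ! k = t ! k" if "Suc k \<le> max_pos xs X" for k
  proof (rule ccontr)
    assume "u ! k \<noteq> t ! k"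
    \<comment> \<open>Index \<open>k\<close> is position \<open>Suc k\<close>. By
      \<open>max_pos_le\<close> the subtraction is not truncated, so the bound on \<open>j\<close>
      says exactly \<open>j \<le> max_pos xs X\<close>.\<close>
    then have "\<exists>j. 1 \<le> j \<and> j + (length xs + 1 - max_pos xs X) \<le> length xs + 1 \<and> u ! (j - 1) \<noteq> t ! (j - 1)"
      using that max_pos_le[of xs X] by (intro exI[of _ "Suc k"]) auto
    then show False using skipped u less by (simp add: next_cands_def)
  qed
  have cor: "v \<longleftrightarrow> holds_at t" "X \<subseteq> set xs"
    "(\<forall>x\<in>X. tuple_subst \<Sigma> nm xs u x = tuple_subst \<Sigma> nm xs t x) \<longrightarrow> (holds_at u \<longleftrightarrow> v)"
    using bspec[OF correct[unfolded eval_correct_def] imageI[OF t]] u ev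
    by (auto simp: holds_at_def)
  have "tuple_subst \<Sigma> nm xs u x = tuple_subst \<Sigma> nm xs t x" if "x \<in> X" for x
  proof -
    have "x \<in> set xs" using that cor(2) by blast
    then obtain k where "k < length xs" "x = xs ! k" by (auto simp: in_set_conv_nth)
    then show ?thesis
      using that eq[OF max_pos_ge[of k xs X]] tuple_subst_nth[OF distinct_xs t] tuple_subst_nth[OF distinct_xs u]
      by simp
  qed
  then show ?thesis using cor by blast
qed

text \<open>A successor chosen among the candidates lies above \<open>t\<close> and so is never
  \<open>vmin\<close>; reaching \<open>vmin\<close> therefore signals unambiguously that no
  candidate was left.\<close>

lemma next_tuple_cases:
  assumes "t \<in> T"
  obtains "next_tuple \<Sigma> M lt xs i t = vmin" "next_cands \<Sigma> M lt xs i t = {}"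
  | "next_tuple \<Sigma> M lt xs i t \<in> T" "next_tuple \<Sigma> M lt xs i t \<noteq> vmin" "t \<sqsubset> next_tuple \<Sigma> M lt xs i t"
    "\<And>u. u \<sqsubset> next_tuple \<Sigma> M lt xs i t \<Longrightarrow> u \<notin> next_cands \<Sigma> M lt xs i t"
proof (cases "next_cands \<Sigma> M lt xs i t = {}")
  case True
  then show ?thesis using that(1) by (simp add: next_tuple_def)
next
  case False
  let ?C = "next_cands \<Sigma> M lt xs i t" and ?u = "next_tuple \<Sigma> M lt xs i t"
  have sub: "?C \<subseteq> T" by (auto simp: next_cands_def)
  have u: "?u = lex_min \<Sigma> lt xs ?C" using False by (simp add: next_tuple_def)
  have "?u \<in> ?C" using lex_min_least(1)[OF sub False] u by simp
  then have in_T: "?u \<in> T" and less: "t \<sqsubset> ?u" by (auto simp: next_cands_def)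
  show ?thesis
  proof (rule that(2)[OF in_T _ less])
    show "?u \<noteq> vmin" using less not_less_vmin assms by metis
    show "w \<notin> ?C" if "w \<sqsubset> ?u" for w
      using lex_min_least(2)[OF sub False, of w] that irrefl_less trans_less u by metis
  qed
qed

text \<open>At \<open>vmin\<close> the invariant speaks of the state after the tuples have been exhausted, not of the
  initial state.\<close>

definition inv_loop :: "('v \<Rightarrow> ('f, 'v) tm) set \<times> 'a list \<Rightarrow> bool" where
  "inv_loop = (\<lambda>(\<Theta>, t). t \<in> T \<and>
     (\<Theta> = {} \<longleftrightarrow> (\<forall>u\<in>T. t = vmin \<or> u \<sqsubset> t \<longrightarrow> holds_at u)))"

text \<open>Termination measure. The \<open>Suc\<close> keeps even the largest tuple, if it is not
  \<open>vmin\<close>, above the value 0 reserved for the wrap-around.\<close>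

definition rank :: "'a list \<Rightarrow> nat" where
  "rank t = (if t = vmin then 0 else Suc (card {u\<in>T. t \<sqsubset> u}))"

text \<open>The premise on \<open>\<Theta>\<close> speaks only of tuples below \<open>t\<close>,
  whereas \<open>inv_loop\<close> reads \<open>vmin\<close> as the end. Thus the lemma covers both
  the first run of the body, which starts at \<open>vmin\<close>, and every later run.\<close>

lemma body_step:
  assumes t: "t \<in> T" and \<Theta>: "\<Theta> = {} \<longleftrightarrow> (\<forall>u\<in>T. u \<sqsubset> t \<longrightarrow> holds_at u)"
  shows "inv_loop (body (\<Theta>, t))" and "t \<noteq> vmin \<Longrightarrow> rank (snd (body (\<Theta>, t))) < rank t"
proof -
  obtain v X where ev: "eval M \<phi> (tuple_subst \<Sigma> nm xs t) = (v, X)" by fastforce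
  define i where "i = length xs + 1 - max_pos xs X"
  define \<Theta>' where "\<Theta>' = (if v then \<Theta> else insert (tuple_subst \<Sigma> nm xs t) \<Theta>)"
  let ?t' = "next_tuple \<Sigma> M lt xs i t"
  have body: "body (\<Theta>, t) = (\<Theta>', ?t')"
    by (simp add: Hm_body_def ev i_def \<Theta>'_def)
  have "v \<longleftrightarrow> holds_at t"
    using correct t ev unfolding eval_correct_def holds_at_def by fastforce
  then have \<Theta>': "\<Theta>' = {} \<longleftrightarrow> holds_at t \<and> (\<forall>u\<in>T. u \<sqsubset> t \<longrightarrow> holds_at u)"
    using \<Theta> by (auto simp: \<Theta>'_def)
  have skipped: "holds_at u \<longleftrightarrow> holds_at t"
    if "u \<in> T" "t \<sqsubset> u" "u \<notin> next_cands \<Sigma> M lt xs i t" for u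
    using holds_at_skipped[OF t that(1) ev that(2)] that(3) by (simp add: i_def)
  have "inv_loop (\<Theta>', ?t') \<and> (t \<noteq> vmin \<longrightarrow> rank ?t' < rank t)"
    using t
  proof (cases rule: next_tuple_cases[where i = i])
    case 1
    \<comment> \<open>Without candidates all tuples above \<open>t\<close> are skipped and share the
      truth value at \<open>t\<close>; by totality nothing else remains.\<close>
    have "\<Theta>' = {} \<longleftrightarrow> (\<forall>u\<in>T. holds_at u)"
      using \<Theta>' skipped total_less t 1(2) by (metis empty_iff)
    then show ?thesis using 1(1) vmin_in_T by (auto simp: inv_loop_def rank_def)
  next
    case 2
    \<comment> \<open>A tuple below \<open>?t'\<close> is below \<open>t\<close>, equal to
      \<open>t\<close>, or strictly between them and then skipped.\<close>
    have "\<Theta>' = {} \<longleftrightarrow> (\<forall>u\<in>T. u \<sqsubset> ?t' \<longrightarrow> holds_at u)"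
      using \<Theta>' skipped total_less trans_less t 2(3,4) by metis
    \<comment> \<open>The inclusion is strict because \<open>?t'\<close> itself lies above
      \<open>t\<close> but not above itself.\<close>
    moreover have "{u\<in>T. ?t' \<sqsubset> u} \<subset> {u\<in>T. t \<sqsubset> u}"
      using 2(1,3) trans_less irrefl_less by blast
    then have "card {u\<in>T. ?t' \<sqsubset> u} < card {u\<in>T. t \<sqsubset> u}"
      using finite_T by (intro psubset_card_mono) auto
    ultimately show ?thesis using 2 by (simp add: inv_loop_def rank_def)
  qed
  then show "inv_loop (body (\<Theta>, t))" "t \<noteq> vmin \<Longrightarrow> rank (snd (body (\<Theta>, t))) < rank t"
    using body by auto
qed

lemma Hm_terminates_correct:
  "\<exists>\<Theta>. Hm \<Sigma> lt nm eval M xs \<phi> = Some \<Theta> \<and> (\<Theta> = {} \<longleftrightarrow> (\<forall>t\<in>T. holds_at t))"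
proof -
  let ?b = "\<lambda>(\<Theta> :: ('v \<Rightarrow> ('f, 'v) tm) set, t). t \<noteq> vmin" and ?s = "body ({}, vmin)"
  \<comment> \<open>Nothing lies below \<open>vmin\<close>, so the premise of
    \<open>body_step\<close> holds trivially for the empty set.\<close>
  have init: "inv_loop ?s"
    using body_step(1)[OF vmin_in_T, of "{}"] not_less_vmin by blast
  have step: "inv_loop (body s) \<and> rank (snd (body s)) < rank (snd s)"
    if "inv_loop s" "?b s" for s
  proof (cases s)
    case (Pair \<Theta> t)
    \<comment> \<open>The loop test removes the alternative \<open>t = vmin\<close> from the
      invariant, which leaves the premise of \<open>body_step\<close>.\<close>
    then have "t \<in> T" "t \<noteq> vmin" "\<Theta> = {} \<longleftrightarrow> (\<forall>u\<in>T. u \<sqsubset> t \<longrightarrow> holds_at u)"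
      using that unfolding inv_loop_def by simp_all
    from body_step[OF this(1,3)] this(2) show ?thesis using Pair by simp
  qed
  obtain s where s: "while_option ?b body ?s = Some s"
    using measure_while_option_Some[of inv_loop ?b body "\<lambda>s. rank (snd s)", OF step init] by blast
  have "inv_loop s"
    using while_option_rule[where P = inv_loop, OF _ s init] step by blast
  moreover have "snd s = vmin"
    using while_option_stop[OF s] by (auto split: prod.splits)
  \<comment> \<open>With \<open>t = vmin\<close> on exit, the invariant ranges over all of
    \<open>T\<close>.\<close>
  ultimately have "fst s = {} \<longleftrightarrow> (\<forall>t\<in>T. holds_at t)"
    by (auto simp: inv_loop_def split: prod.splits)
  then show ?thesis using s by (simp add: Hm_def)
qed

end

theorem theorem5:
  fixes \<Sigma> :: "('f, 'p, 'v, 's) signature"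
    and M :: "('f, 'p, 's, 'a) interp"
    and xs :: "'v list"
    and \<phi> :: "('f, 'p, 'v) qf"
    and lt :: "'s \<Rightarrow> ('a \<times> 'a) set"
    and nm :: "'s \<Rightarrow> 'a \<Rightarrow> ('f, 'v) tm"
    and eval :: "('f, 'p, 'v, 's, 'a) eval_proc"
  assumes "interpretation_of \<Sigma> M"
    and "wf_qf \<Sigma> \<phi>"
    and "distinct xs"
    and "vars_qf \<phi> \<subseteq> set xs"
    and "\<And>x. x \<in> set xs \<Longrightarrow> finite (dom_of M (var_sort \<Sigma> x)) \<and> dom_of M (var_sort \<Sigma> x) \<noteq> {}"
    and "\<And>x. x \<in> set xs \<Longrightarrow> names_elements \<Sigma> M nm (var_sort \<Sigma> x)"
    and "\<And>x. x \<in> set xs \<Longrightarrow> strict_linear_order_on (dom_of M (var_sort \<Sigma> x)) (lt (var_sort \<Sigma> x))"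
    and "eval_correct \<Sigma> M nm xs \<phi> eval"
  shows "\<exists>\<Theta>. Hm \<Sigma> lt nm eval M xs \<phi> = Some \<Theta> \<and> (\<Theta> = {} \<longleftrightarrow> models_forall \<Sigma> M xs \<phi>)"
proof -
  interpret instantiation_setting \<Sigma> M xs \<phi> lt nm eval
    using assms by unfold_locales auto
  show ?thesis
    using Hm_terminates_correct models_forall_iff_tuples[OF assms(3,4,6)]
    unfolding holds_at_def by blast
qed

end
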